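(* Let $(M,*,0,\leq)$ be a dense unital magma and $(X,d)$ an $M$-metric space. Then any convergent sequence in $X$ is a Cauchy sequence.
   Context: A unital magma $(M,*,0)$ is a set $M$ with a binary operation $*$ (not necessarily associative or commutative) and an element $0$ with $m*0=0*m=m$ for all $m$. An ordered unital magma $(M,*,0,\leq)$ is a unital magma with a partial ordering $\leq$ such that $a\leq b$ implies $a*c\leq b*c$ and $c*a\leq c*b$ for all $a,b,c\in M$. Write $a<b$ if $a\leq b$ and $a\neq b$; $m$ is positive if $0<m$. An ordered unital magma $M$ is a dense unital magma if for every positive $\epsilon\in M$ there are positive $\beta,\gamma\in M$ with $\beta*\gamma<\epsilon$. For an ordered unital magma $M$, $(X,d)$ is an $M$-metric space if $d:X\times X\to M$ satisfies, for all $x,y,z\in X$: (1) $d(x,y)\geq 0$, and $d(x,y)=0$ if and only if $x=y$; (2) $d(x,y)=d(y,x)$; (3) $d(x,z)\leq d(x,y)*d(y,z)$. A sequence $(x_n)$ in $X$ is convergent to $x\in X$ if for any positive $\epsilon\in M$ there is a natural number $N$ such that $n\geq N$ implies $d(x_n,x)<\epsilon$; it is convergent if it is convergent to some $x\in X$. It is a Cauchy sequence if for any positive $\epsilon\in M$ there is a natural number $N$ such that $m,n\geq N$ implies $d(x_m,x_n)<\epsilon$. *)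

theory Defs
  imports Main
begin

text \<open>
  Structures are given by explicit carrier sets. Operations, orderings and distances are total
  functions on the ambient types, but only their values on the carriers are constrained.
\<close>

locale unital_magma =
  fixes M :: "'m set"
    and mult :: "'m \<Rightarrow> 'm \<Rightarrow> 'm"  (infixl \<open>\<odot>\<close> 70)
    and zero :: 'm  (\<open>\<zero>\<close>)
  assumes mult_closed: "\<lbrakk>a \<in> M; b \<in> M\<rbrakk> \<Longrightarrow> a \<odot> b \<in> M"
    and zero_closed: "\<zero> \<in> M"
    and mult_zero: "m \<in> M \<Longrightarrow> m \<odot> \<zero> = m"
    and zero_mult: "m \<in> M \<Longrightarrow> \<zero> \<odot> m = m"

locale ordered_unital_magma = unital_magma M mult zero
  for M :: "'m set"
    and mult :: "'m \<Rightarrow> 'm \<Rightarrow> 'm"  (infixl \<open>\<odot>\<close> 70)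
    and zero :: 'm  (\<open>\<zero>\<close>) +
  fixes le :: "'m \<Rightarrow> 'm \<Rightarrow> bool"  (infix \<open>\<sqsubseteq>\<close> 50)
  assumes refl: "reflp_on M (\<sqsubseteq>)"
    and antisym: "antisymp_on M (\<sqsubseteq>)"
    and trans: "transp_on M (\<sqsubseteq>)"
    and mult_right_mono: "\<lbrakk>a \<in> M; b \<in> M; c \<in> M; a \<sqsubseteq> b\<rbrakk> \<Longrightarrow> a \<odot> c \<sqsubseteq> b \<odot> c"
    and mult_left_mono: "\<lbrakk>a \<in> M; b \<in> M; c \<in> M; a \<sqsubseteq> b\<rbrakk> \<Longrightarrow> c \<odot> a \<sqsubseteq> c \<odot> b"
begin

definition less :: "'m \<Rightarrow> 'm \<Rightarrow> bool"  (infix \<open>\<sqsubset>\<close> 50)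
  where "a \<sqsubset> b \<longleftrightarrow> a \<sqsubseteq> b \<and> a \<noteq> b"

definition positives :: "'m set"
  where "positives = {m \<in> M. \<zero> \<sqsubset> m}"

end

locale dense_unital_magma = ordered_unital_magma M mult zero le
  for M :: "'m set"
    and mult :: "'m \<Rightarrow> 'm \<Rightarrow> 'm"  (infixl \<open>\<odot>\<close> 70)
    and zero :: 'm  (\<open>\<zero>\<close>)
    and le :: "'m \<Rightarrow> 'm \<Rightarrow> bool"  (infix \<open>\<sqsubseteq>\<close> 50) +
  assumes dense: "\<epsilon> \<in> positives \<Longrightarrow> \<exists>\<beta>\<in>positives. \<exists>\<gamma>\<in>positives. \<beta> \<odot> \<gamma> \<sqsubset> \<epsilon>"

locale magma_metric_space = ordered_unital_magma M mult zero le
  for M :: "'m set"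
    and mult :: "'m \<Rightarrow> 'm \<Rightarrow> 'm"  (infixl \<open>\<odot>\<close> 70)
    and zero :: 'm  (\<open>\<zero>\<close>)
    and le :: "'m \<Rightarrow> 'm \<Rightarrow> bool"  (infix \<open>\<sqsubseteq>\<close> 50) +
  fixes X :: "'x set"
    and d :: "'x \<Rightarrow> 'x \<Rightarrow> 'm"
  assumes dist_closed: "\<lbrakk>x \<in> X; y \<in> X\<rbrakk> \<Longrightarrow> d x y \<in> M"
    and dist_nonneg: "\<lbrakk>x \<in> X; y \<in> X\<rbrakk> \<Longrightarrow> \<zero> \<sqsubseteq> d x y"
    and dist_eq_zero_iff: "\<lbrakk>x \<in> X; y \<in> X\<rbrakk> \<Longrightarrow> d x y = \<zero> \<longleftrightarrow> x = y"
    and dist_commute: "\<lbrakk>x \<in> X; y \<in> X\<rbrakk> \<Longrightarrow> d x y = d y x"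
    and dist_triangle: "\<lbrakk>x \<in> X; y \<in> X; z \<in> X\<rbrakk> \<Longrightarrow> d x z \<sqsubseteq> d x y \<odot> d y z"
begin

definition sequence_in :: "(nat \<Rightarrow> 'x) \<Rightarrow> bool"
  where "sequence_in s \<longleftrightarrow> range s \<subseteq> X"

definition converges_to :: "(nat \<Rightarrow> 'x) \<Rightarrow> 'x \<Rightarrow> bool"
  where "converges_to s x \<longleftrightarrow> (\<forall>\<epsilon>\<in>positives. \<exists>N. \<forall>n\<ge>N. d (s n) x \<sqsubset> \<epsilon>)"

definition convergent_seq :: "(nat \<Rightarrow> 'x) \<Rightarrow> bool"
  where "convergent_seq s \<longleftrightarrow> sequence_in s \<and> (\<exists>x\<in>X. converges_to s x)"

definition Cauchy_seq :: "(nat \<Rightarrow> 'x) \<Rightarrow> bool"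
  where "Cauchy_seq s \<longleftrightarrow>
    sequence_in s \<and> (\<forall>\<epsilon>\<in>positives. \<exists>N. \<forall>m\<ge>N. \<forall>n\<ge>N. d (s m) (s n) \<sqsubset> \<epsilon>)"

end

end

theory Submission
  imports Defs
begin

text \<open>Density replaces the halving of \<epsilon>: choose positive \<beta>, \<gamma> with
  \<open>mult \<beta> \<gamma>\<close> strictly below \<epsilon>. If \<open>s m\<close> is within
  \<beta> of the limit \<open>x\<close> and \<open>s n\<close> within \<gamma>, the triangle
  inequality through \<open>x\<close> and monotonicity in both factors (\<open>mult_mono\<close>)
  bound \<open>d (s m) (s n)\<close> by \<open>mult \<beta> \<gamma>\<close>;
  \<open>le_less_trans\<close> then gives the strict bound.\<close>

context ordered_unital_magma
begin

lemma le_trans: "\<lbrakk>a \<in> M; b \<in> M; c \<in> M; a \<sqsubseteq> b; b \<sqsubseteq> c\<rbrakk> \<Longrightarrow> a \<sqsubseteq> c"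
  using trans by (blast dest: transp_onD)

text \<open>Strictness survives by antisymmetry: if \<open>a = c\<close>, then \<open>a\<close> and
  \<open>b\<close> lie below each other, so \<open>b = c\<close>, against
  \<open>b \<sqsubset> c\<close>.\<close>

lemma le_less_trans: "\<lbrakk>a \<in> M; b \<in> M; c \<in> M; a \<sqsubseteq> b; b \<sqsubset> c\<rbrakk> \<Longrightarrow> a \<sqsubset> c"
  unfolding less_def using le_trans antisym by (blast dest: antisymp_onD)

text \<open>Replace one factor at a time, using monotonicity on each side, and join the two steps by
  transitivity.\<close>

lemma mult_mono:
  assumes "a \<in> M" "a' \<in> M" "b \<in> M" "b' \<in> M" "a \<sqsubseteq> a'" "b \<sqsubseteq> b'"
  shows "a \<odot> b \<sqsubseteq> a' \<odot> b'"
  using assms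
  by (meson le_trans mult_closed mult_left_mono mult_right_mono)

end

theorem theorem3p15:
  fixes M :: "'m set" and mult :: "'m \<Rightarrow> 'm \<Rightarrow> 'm" and zero :: 'm and le :: "'m \<Rightarrow> 'm \<Rightarrow> bool"
    and X :: "'x set" and d :: "'x \<Rightarrow> 'x \<Rightarrow> 'm" and s :: "nat \<Rightarrow> 'x"
  assumes "dense_unital_magma M mult zero le"
    and "magma_metric_space M mult zero le X d"
    and "magma_metric_space.convergent_seq M zero le X d s"
  shows "magma_metric_space.Cauchy_seq M zero le X d s"
proof -
  interpret dense_unital_magma M mult zero le by fact
  interpret magma_metric_space M mult zero le X d by fact
  from assms(3) obtain x where s: "sequence_in s" and x: "x \<in> X" and lim: "converges_to s x"
    unfolding convergent_seq_def by blast
  have sX: "s n \<in> X" for n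
    using s unfolding sequence_in_def by blast
  have "\<exists>N. \<forall>m\<ge>N. \<forall>n\<ge>N. less (d (s m) (s n)) \<epsilon>" if \<epsilon>: "\<epsilon> \<in> positives" for \<epsilon>
  proof -
    obtain \<beta> \<gamma> where \<beta>: "\<beta> \<in> positives" and \<gamma>: "\<gamma> \<in> positives" and small: "less (mult \<beta> \<gamma>) \<epsilon>"
      using dense[OF \<epsilon>] by blast
    have M: "\<beta> \<in> M" "\<gamma> \<in> M" "\<epsilon> \<in> M"
      using \<beta> \<gamma> \<epsilon> by (auto simp: positives_def)
    \<comment> \<open>Only the weak inequality is kept, since multiplication is assumed monotone for
      \<open>le\<close> alone; the strictness of the final bound comes from
      \<open>small\<close>.\<close>
    obtain K where K: "\<And>n. n \<ge> K \<Longrightarrow> le (d (s n) x) \<beta>"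
      using lim \<beta> unfolding converges_to_def less_def by blast
    obtain L where L: "\<And>n. n \<ge> L \<Longrightarrow> le (d (s n) x) \<gamma>"
      using lim \<gamma> unfolding converges_to_def less_def by blast
    have "less (d (s m) (s n)) \<epsilon>" if m: "m \<ge> max K L" and n: "n \<ge> max K L" for m n
    proof -
      have "le (d (s m) (s n)) (mult (d (s m) x) (d x (s n)))"
        by (intro dist_triangle sX x)
      moreover have "le (mult (d (s m) x) (d x (s n))) (mult \<beta> \<gamma>)"
        \<comment> \<open>Symmetry turns \<open>d x (s n)\<close> into \<open>d (s n) x\<close>, the
          form that \<open>L\<close> bounds.\<close>
        using K[of m] L[of n] m n dist_commute[OF x sX]
        by (intro mult_mono dist_closed sX x M) auto
      ultimately have "le (d (s m) (s n)) (mult \<beta> \<gamma>)"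
        \<comment> \<open>The rotation puts the order premises first, to match the chained facts;
          the carrier memberships remain as goals.\<close>
        by (rule le_trans[rotated 3]) (intro mult_closed dist_closed sX x M)+
      then show ?thesis
        using small by (rule le_less_trans[rotated 3]) (intro mult_closed dist_closed sX M)+
    qed
    then show ?thesis by blast
  qed
  with s show ?thesis unfolding Cauchy_seq_def by blast
qed

end
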